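(* Let $C_n(p,q,t)$, $n\ge 0$, be the polynomials in $p,q,t$ defined as the Taylor coefficients in $z$ of the continued fraction $$\sum_{n\geq0} C_n(p,q,t)z^n=\cfrac{1}{1-1\cdot z-\cfrac{tp\, z^{2}}{1-(p+q) z-\cfrac{tp^2q\, z^{2}}{1-(p^2+q^2) z-\cfrac{tp^3q^2\, z^2}{1-(p^3+q^3) z-\cfrac{tp^4q^3\, z^2}{1-\cdots}}}}}$$ (the coefficient of $z$ at level $0$ is $1$ and at level $h\ge1$ is $p^h+q^h$; the $h$-th partial numerator, $h\ge 1$, is $t\,p^{h}q^{h-1}z^2$). Then for every $n$, $$C_n(p,q,t)=\sum_{\sigma\in\mathfrak{S}_n(321)}p^{\widehat{(2\text{-}13)}\,\sigma}\,q^{(31\text{-}2)\,\sigma}\,t^{\mathrm{des}\,\sigma}.$$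
   Context: $\mathfrak S_n$ is the set of permutations $\sigma=\sigma(1)\cdots\sigma(n)$ of $[n]=\{1,\dots,n\}$, and $\mathfrak S_n(321)$ is the subset of permutations avoiding the classical pattern $321$ (no $i<j<k$ with $\sigma(i)>\sigma(j)>\sigma(k)$). $\mathrm{des}\,\sigma$ is the number of $i$ with $1\le i<n$ and $\sigma(i)>\sigma(i+1)$. For $\sigma\in\mathfrak S_n$ define $$(31\text{-}2)\,\sigma=\sum_{i=1}^n\#\{j:1<j<i,\ \sigma(j)<\sigma(i)<\sigma(j-1)\}.$$ With the convention $\sigma(n+1)=n+1$, define $$\widehat{(2\text{-}13)}\,\sigma=\sum_{i=1}^n\#\{j: i<j\le n,\ \sigma(j)<\sigma(i)<\sigma(j+1)\}.$$ Continued fractions are understood as formal power series in $z$. *)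

theory Defs
  imports
    "HOL-Combinatorics.Permutations"
    "HOL-Computational_Algebra.Formal_Power_Series"
begin

(* A permutation of {1..n} is a function with "\<sigma> permutes {1..n}". Such a function is the
   identity outside {1..n}, so the convention \<sigma>(n+1) = n+1 of the statistic stat_2_13_hat
   below holds automatically. *)

definition avoids_321 :: "nat \<Rightarrow> (nat \<Rightarrow> nat) \<Rightarrow> bool" where
  "avoids_321 n \<sigma> \<longleftrightarrow>
     \<not> (\<exists>i j k. 1 \<le> i \<and> i < j \<and> j < k \<and> k \<le> n \<and> \<sigma> i > \<sigma> j \<and> \<sigma> j > \<sigma> k)"

definition perms_321 :: "nat \<Rightarrow> (nat \<Rightarrow> nat) set" where
  "perms_321 n = {\<sigma>. \<sigma> permutes {1..n} \<and> avoids_321 n \<sigma>}"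

definition des :: "nat \<Rightarrow> (nat \<Rightarrow> nat) \<Rightarrow> nat" where
  "des n \<sigma> = card {i. 1 \<le> i \<and> i < n \<and> \<sigma> i > \<sigma> (i + 1)}"

definition stat_31_2 :: "nat \<Rightarrow> (nat \<Rightarrow> nat) \<Rightarrow> nat" where
  "stat_31_2 n \<sigma> = (\<Sum>i=1..n. card {j. 1 < j \<and> j < i \<and> \<sigma> j < \<sigma> i \<and> \<sigma> i < \<sigma> (j - 1)})"

definition stat_2_13_hat :: "nat \<Rightarrow> (nat \<Rightarrow> nat) \<Rightarrow> nat" where
  "stat_2_13_hat n \<sigma> = (\<Sum>i=1..n. card {j. i < j \<and> j \<le> n \<and> \<sigma> j < \<sigma> i \<and> \<sigma> i < \<sigma> (j + 1)})"

(* The reciprocal of a power series with constant coefficient 1, over any commutative ring. *)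
definition fps_recip :: "'a::comm_ring_1 fps \<Rightarrow> 'a fps" where
  "fps_recip f = fps_right_inverse f 1"

(* jfrac_conv b l N h is the continued fraction that starts at level h,
     1 / (1 - b(h) z - l(h+1) z^2 / (1 - b(h+1) z - l(h+2) z^2 / (1 - ...))),
   cut off after N levels. *)
primrec jfrac_conv ::
  "(nat \<Rightarrow> 'a::comm_ring_1) \<Rightarrow> (nat \<Rightarrow> 'a) \<Rightarrow> nat \<Rightarrow> nat \<Rightarrow> 'a fps" where
  "jfrac_conv b l 0 h = 0"
| "jfrac_conv b l (Suc N) h =
     fps_recip (1 - fps_const (b h) * fps_X
                  - fps_const (l (Suc h)) * fps_X ^ 2 * jfrac_conv b l N (Suc h))"

(* The infinite continued fraction is the limit of its convergents in the z-adic topology;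
   jfrac_conv_tendsto below shows that the limit exists. *)
definition jfrac :: "(nat \<Rightarrow> 'a::comm_ring_1) \<Rightarrow> (nat \<Rightarrow> 'a) \<Rightarrow> 'a fps" where
  "jfrac b l = lim (\<lambda>N. jfrac_conv b l N 0)"

(* p, q and t range over an arbitrary commutative ring: the indeterminates of a polynomial ring
   are one instance. The partial numerators l(h) are only used for h \<ge> 1. *)
definition C_poly :: "nat \<Rightarrow> 'a::comm_ring_1 \<Rightarrow> 'a \<Rightarrow> 'a \<Rightarrow> 'a" where
  "C_poly n p q t =
     fps_nth (jfrac (\<lambda>h. if h = 0 then 1 else p ^ h + q ^ h)
                    (\<lambda>h. t * p ^ h * q ^ (h - 1))) n"

lemma fps_recip_mult:
  assumes "fps_nth f 0 = 1"
  shows "f * fps_recip f = 1"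
  unfolding fps_recip_def by (rule fps_right_inverse) (use assms in simp)

lemma jfrac_conv_Suc_mult:
  "(1 - fps_const (b h) * fps_X - fps_const (l (Suc h)) * fps_X ^ 2 * jfrac_conv b l N (Suc h))
     * jfrac_conv b l (Suc N) h = 1"
  unfolding jfrac_conv.simps
  by (rule fps_recip_mult) (simp add: mult.assoc power2_eq_square)

lemma jfrac_conv_diff:
  "\<exists>g. jfrac_conv b l (N + M) h - jfrac_conv b l N h = fps_X ^ N * g"
proof (induction N arbitrary: h)
  case 0
  show ?case by simp
next
  case (Suc N)
  define D where "D = (\<lambda>K. 1 - fps_const (b h) * fps_X
    - fps_const (l (Suc h)) * fps_X ^ 2 * jfrac_conv b l K (Suc h))"
  define J where "J = (\<lambda>K. jfrac_conv b l (Suc K) h)"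
  have inv: "D K * J K = 1" for K
    unfolding D_def J_def by (rule jfrac_conv_Suc_mult)
  obtain g where g: "jfrac_conv b l (N + M) (Suc h) - jfrac_conv b l N (Suc h) = fps_X ^ N * g"
    using Suc by blast
  have "D N - D (N + M) = fps_const (l (Suc h)) * fps_X ^ 2 *
      (jfrac_conv b l (N + M) (Suc h) - jfrac_conv b l N (Suc h))"
    by (simp add: D_def algebra_simps)
  then have D: "D N - D (N + M) = fps_X ^ Suc N * (fps_const (l (Suc h)) * fps_X * g)"
    by (simp add: g power2_eq_square mult_ac)
  have "J (N + M) - J N = (D N * J N) * J (N + M) - (D (N + M) * J (N + M)) * J N"
    by (simp add: inv)
  also have "\<dots> = (D N - D (N + M)) * (J N * J (N + M))"
    by (simp add: algebra_simps)
  also have "\<dots> = fps_X ^ Suc N * (fps_const (l (Suc h)) * fps_X * g * (J N * J (N + M)))"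
    unfolding D by (simp only: mult.assoc)
  finally show ?case unfolding J_def by auto
qed

lemma jfrac_conv_nth_stable:
  assumes "n < N" and "N \<le> M"
  shows "fps_nth (jfrac_conv b l M h) n = fps_nth (jfrac_conv b l N h) n"
proof -
  obtain g where "jfrac_conv b l (N + (M - N)) h - jfrac_conv b l N h = fps_X ^ N * g"
    using jfrac_conv_diff by blast
  then have "fps_nth (jfrac_conv b l M h - jfrac_conv b l N h) n = fps_nth (fps_X ^ N * g) n"
    using assms by simp
  then show ?thesis using assms by (simp add: fps_X_power_mult_nth)
qed

lemma jfrac_conv_tendsto: "(\<lambda>N. jfrac_conv b l N 0) \<longlonglongrightarrow> jfrac b l"
proof -
  have "(\<lambda>N. jfrac_conv b l N 0) \<longlonglongrightarrow> Abs_fps (\<lambda>n. fps_nth (jfrac_conv b l (Suc n) 0) n)"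
  proof (rule tendsto_fpsI)
    fix n
    show "\<forall>\<^sub>F N in sequentially. fps_nth (jfrac_conv b l N 0) n =
        fps_nth (Abs_fps (\<lambda>n. fps_nth (jfrac_conv b l (Suc n) 0) n)) n"
      unfolding fps_nth_Abs_fps eventually_sequentially
      by (intro exI[of _ "Suc n"] allI impI jfrac_conv_nth_stable) auto
  qed
  then have "convergent (\<lambda>N. jfrac_conv b l N 0)"
    by (auto simp: convergent_def)
  then show ?thesis unfolding jfrac_def convergent_LIMSEQ_iff .
qed

end

theory Submission
  imports Defs
begin

text \<open>
  Build a permutation by inserting the values \<open>1, 2, \<dots>, n\<close> in this order, keeping track of the
  maximal blocks of adjacent positions that are already filled; the height is the number of blocks
  other than the (possibly empty) one at the very beginning. In a 321-avoiding permutation a value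
  cannot have both a larger value to its left and a smaller one to its right, so at height \<open>h\<close> the
  next value is either appended to the last block (factor \<open>q^h\<close>), or opens a new last block
  (\<open>t q^h\<close>, height \<open>h + 1\<close>), or, if \<open>h > 0\<close>, is appended to the initial block (\<open>p^h\<close>) or glues
  the initial block to the next one (\<open>p^h\<close>, height \<open>h - 1\<close>). These are the steps of a weighted
  Motzkin path, and the generating function of such paths is the continued fraction.
\<close>

subsection \<open>J-fractions and Motzkin paths\<close>

text \<open>The sum over Motzkin paths of length \<open>n\<close> from height \<open>0\<close> to height \<open>h\<close>; here \<open>d h\<close> weighs
  the step from \<open>h + 1\<close> down to \<open>h\<close>, while \<open>u h\<close> weighs the step from \<open>h\<close> up to \<open>h + 1\<close>.\<close>

primrec motzkin_sum ::
  "(nat \<Rightarrow> 'a::comm_ring_1) \<Rightarrow> (nat \<Rightarrow> 'a) \<Rightarrow> (nat \<Rightarrow> 'a) \<Rightarrow> nat \<Rightarrow> nat \<Rightarrow> 'a" where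
  "motzkin_sum b u d 0 h = of_bool (h = 0)"
| "motzkin_sum b u d (Suc n) h = b h * motzkin_sum b u d n h
     + (case h of 0 \<Rightarrow> 0 | Suc k \<Rightarrow> u k * motzkin_sum b u d n k)
     + d h * motzkin_sum b u d n (Suc h)"

text \<open>The coefficient of \<open>z^n\<close> is constant from the convergent with
  \<open>n + 1\<close> levels on, so the series of these stable values is the limit, and limits are
  unique.\<close>

lemma jfrac_nth: "fps_nth (jfrac b l) n = fps_nth (jfrac_conv b l (Suc n) 0) n"
proof -
  have "(\<lambda>N. jfrac_conv b l N 0) \<longlonglongrightarrow> Abs_fps (\<lambda>n. fps_nth (jfrac_conv b l (Suc n) 0) n)"
  proof (rule tendsto_fpsI)
    fix n
    show "\<forall>\<^sub>F N in sequentially. fps_nth (jfrac_conv b l N 0) n =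
        fps_nth (Abs_fps (\<lambda>n. fps_nth (jfrac_conv b l (Suc n) 0) n)) n"
      unfolding fps_nth_Abs_fps eventually_sequentially
      by (intro exI[of _ "Suc n"] allI impI jfrac_conv_nth_stable) auto
  qed
  then have "jfrac b l = Abs_fps (\<lambda>n. fps_nth (jfrac_conv b l (Suc n) 0) n)"
    using jfrac_conv_tendsto LIMSEQ_unique by blast
  then show ?thesis by simp
qed

text \<open>If \<open>G h\<close> generates the paths ending at height \<open>h\<close>, cutting at the last step from \<open>h\<close> to \<open>h + 1\<close>
  makes \<open>G (h + 1)\<close> the product of \<open>G h\<close>, that step, and the paths that stay above \<open>h\<close>; replacing
  the last factor by the \<open>N\<close>-th convergent leaves an error of order \<open>N\<close>.\<close>

lemma jfrac_conv_remainder: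
  fixes G :: "nat \<Rightarrow> 'a::comm_ring_1 fps"
  assumes G: "\<And>h. G (Suc h) = fps_X * (fps_const (b h) * G (Suc h) + fps_const (u h) * G h
                                  + fps_const (d h) * G (Suc (Suc h)))"
    and l: "\<And>h. l (Suc h) = u (Suc h) * d h"
  shows "\<exists>g. G (Suc h) - fps_X * fps_const (u h) * jfrac_conv b l N h * G h = fps_X ^ N * g"
proof (induction N arbitrary: h)
  case 0
  show ?case by simp
next
  case (Suc N)
  define J where "J = jfrac_conv b l (Suc N) h"
  define J' where "J' = jfrac_conv b l N (Suc h)"
  obtain g where g: "G (Suc (Suc h)) - fps_X * fps_const (u (Suc h)) * J' * G (Suc h) = fps_X ^ N * g"
    using Suc unfolding J'_def by blast
  have J: "(1 - fps_const (b h) * fps_X - fps_const (u (Suc h)) * fps_const (d h) * fps_X ^ 2 * J') * J = 1"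
    using jfrac_conv_Suc_mult[of b h l N] by (simp add: J_def J'_def l)
  have G': "G (Suc (Suc h)) = fps_X * fps_const (u (Suc h)) * J' * G (Suc h) + fps_X ^ N * g"
    using g by (simp add: algebra_simps)
  have "G (Suc h) = fps_X * (fps_const (b h) * G (Suc h) + fps_const (u h) * G h
          + fps_const (d h) * (fps_X * fps_const (u (Suc h)) * J' * G (Suc h) + fps_X ^ N * g))"
    using G[of h] unfolding G' .
  then have "(1 - fps_const (b h) * fps_X - fps_const (u (Suc h)) * fps_const (d h) * fps_X ^ 2 * J') * G (Suc h)
     = fps_X * fps_const (u h) * G h + fps_X ^ Suc N * (fps_const (d h) * g)"
    by (simp add: algebra_simps power2_eq_square del: fps_const_mult)
  \<comment> \<open>\<open>J\<close> inverts the bracket, so this solves for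
    \<open>G (Suc h)\<close>. The old error has gained one factor \<open>fps_X\<close> from the step
    down.\<close>
  then have "J * ((1 - fps_const (b h) * fps_X - fps_const (u (Suc h)) * fps_const (d h) * fps_X ^ 2 * J') * G (Suc h))
     = J * (fps_X * fps_const (u h) * G h + fps_X ^ Suc N * (fps_const (d h) * g))"
    by simp
  then have "G (Suc h) = J * (fps_X * fps_const (u h) * G h + fps_X ^ Suc N * (fps_const (d h) * g))"
    using J by (metis (no_types, lifting) mult.assoc mult.commute mult_1)
  then have "G (Suc h) - fps_X * fps_const (u h) * J * G h = fps_X ^ Suc N * (J * fps_const (d h) * g)"
    by (simp add: algebra_simps)
  then show ?case unfolding J_def by blast
qed

lemma jfrac_nth_eq_motzkin_sum:
  fixes b :: "nat \<Rightarrow> 'a::comm_ring_1"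
  assumes l: "\<And>h. l (Suc h) = u h * d h"
  shows "fps_nth (jfrac b l) n = motzkin_sum b u d n 0"
proof -
  define M where "M = motzkin_sum b u d"
  \<comment> \<open>shifted by one level, so that \<open>jfrac_conv_remainder\<close> also covers the bottom level\<close>
  define G where "G = (\<lambda>h. case h of 0 \<Rightarrow> 1 | Suc k \<Rightarrow> fps_X * Abs_fps (\<lambda>n. M n k))"
  \<comment> \<open>The value 1 at index 0 weighs an artificial first step from
    \<open>G 0 = 1\<close> into height 0; the true up steps move up by one index.\<close>
  let ?u = "\<lambda>h. case h of 0 \<Rightarrow> 1 | Suc k \<Rightarrow> u k"
  have rec: "G (Suc h) = fps_X * (fps_const (b h) * G (Suc h) + fps_const (?u h) * G h
                                  + fps_const (d h) * G (Suc (Suc h)))" for h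
  proof (rule fps_ext)
    fix n
    show "fps_nth (G (Suc h)) n = fps_nth (fps_X * (fps_const (b h) * G (Suc h)
        + fps_const (?u h) * G h + fps_const (d h) * G (Suc (Suc h)))) n"
    proof (cases n)
      case (Suc m)
      then show ?thesis
        by (cases m) (auto simp: G_def M_def split: nat.split)
    qed (simp add: G_def)
  qed
  \<comment> \<open>\<open>G (Suc 0)\<close> carries an extra factor \<open>fps_X\<close>, so
    coefficient \<open>n + 1\<close> is wanted and the error must have order at least
    \<open>n + 2\<close>.\<close>
  obtain g where "G (Suc 0) - fps_X * fps_const (?u 0) * jfrac_conv b l (Suc (Suc n)) 0 * G 0
      = fps_X ^ Suc (Suc n) * g"
    using jfrac_conv_remainder[of G b ?u d l 0 "Suc (Suc n)", OF rec] l by auto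
  then have "fps_nth (fps_X * (Abs_fps (\<lambda>n. M n 0) - jfrac_conv b l (Suc (Suc n)) 0)) (Suc n)
      = fps_nth (fps_X ^ Suc (Suc n) * g) (Suc n)"
    by (simp add: G_def algebra_simps)
  then have "M n 0 = fps_nth (jfrac_conv b l (Suc (Suc n)) 0) n"
    by (simp add: fps_X_power_mult_nth del: power_Suc jfrac_conv.simps)
  then show ?thesis
    using jfrac_conv_nth_stable[of n "Suc n" "Suc (Suc n)" b l 0]
    by (simp add: jfrac_nth M_def del: jfrac_conv.simps)
qed

subsection \<open>Statistics on words\<close>

fun npairs :: "('a \<Rightarrow> 'a \<Rightarrow> bool) \<Rightarrow> 'a list \<Rightarrow> nat" where
  "npairs P (x # y # r) = of_bool (P x y) + npairs P (y # r)"
| "npairs P _ = 0"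

text \<open>Grouped by the adjacent pair 31, unlike \<open>stat_31_2\<close>, to allow recursion
  from the left; \<open>word_31_2_snoc\<close> recovers the grouping by the letter 2.\<close>

fun word_31_2 :: "nat list \<Rightarrow> nat" where
  "word_31_2 (x # y # r) = length (filter (\<lambda>u. y < u \<and> u < x) r) + word_31_2 (y # r)"
| "word_31_2 _ = 0"

text \<open>The appended \<open>N\<close> plays the value at position \<open>n + 1\<close> in the
  convention of \<open>stat_2_13_hat\<close>.\<close>

primrec word_2_13 :: "nat \<Rightarrow> nat list \<Rightarrow> nat" where
  "word_2_13 N [] = 0"
| "word_2_13 N (u # r) = npairs (\<lambda>x y. x < u \<and> u < y) (r @ [N]) + word_2_13 N r"

text \<open>\<open>sorted_wrt\<close> merely quantifies over all later pairs. Strict inequalities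
  keep equal letters from serving as two letters of one pattern.\<close>

primrec word_avoids_321 :: "nat list \<Rightarrow> bool" where
  "word_avoids_321 [] = True"
| "word_avoids_321 (x # r) \<longleftrightarrow> sorted_wrt (\<lambda>y z. \<not> (y < x \<and> z < y)) r \<and> word_avoids_321 r"

lemma npairs_snoc: "npairs P (xs @ [y]) = npairs P xs + of_bool (xs \<noteq> [] \<and> P (last xs) y)"
  by (induction P xs rule: npairs.induct) auto

lemma npairs_map_upt:
  "npairs P (map f [m..<n]) = card {j. m \<le> j \<and> Suc j < n \<and> P (f j) (f (Suc j))}"
proof (induction n)
  case 0
  show ?case by simp
next
  case (Suc n)
  show ?case
  proof (cases "m < n")
    case True
    then obtain k where k: "n = Suc k" "m \<le> k" by (cases n) auto
    have "{j. m \<le> j \<and> Suc j < Suc n \<and> P (f j) (f (Suc j))} =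
      {j. m \<le> j \<and> Suc j < n \<and> P (f j) (f (Suc j))} \<union> (if P (f k) (f n) then {k} else {})"
      using k by (auto simp: less_Suc_eq)
    moreover have "finite {j. m \<le> j \<and> Suc j < n \<and> P (f j) (f (Suc j))}"
      by (rule finite_subset[of _ "{..n}"]) auto
    moreover from k have "last (map f [m..<n]) = f k" by (simp_all add: last_map)
    then have "npairs P (map f [m..<Suc n]) = npairs P (map f [m..<n]) + of_bool (P (f k) (f n))"
      using True by (simp add: npairs_snoc)
    moreover have "\<not> Suc k < n" using k by simp
    ultimately show ?thesis using Suc by simp
  next
    case False
    then have e: "{j. m \<le> j \<and> Suc j < Suc n \<and> P (f j) (f (Suc j))} = {}" by auto
    show ?thesis using False unfolding e by (cases "m = n") auto
  qed
qed

text \<open>A letter at the very end can only be the 2 of a new occurrence.\<close>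

lemma word_31_2_snoc:
  "word_31_2 (w @ [v]) = word_31_2 w + npairs (\<lambda>x y. y < v \<and> v < x) w"
proof (induction w rule: word_31_2.induct)
  case (1 x y r)
  then show ?case by simp
qed auto

lemma word_31_2_map_upt:
  "word_31_2 (map f [m..<Suc n]) =
    (\<Sum>i=m..n. card {j. m < j \<and> j < i \<and> f j < f i \<and> f i < f (j - 1)})"
proof (induction n)
  case 0
  show ?case by (cases m) auto
next
  case (Suc n)
  \<comment> \<open>\<open>npairs\<close> indexes an adjacent pair by its left position, the
    statistic by its right one; \<open>Suc\<close> translates.\<close>
  have "card {j. m \<le> j \<and> Suc j < Suc n \<and> f (Suc j) < f (Suc n) \<and> f (Suc n) < f j}
     = card {j. m < j \<and> j < Suc n \<and> f j < f (Suc n) \<and> f (Suc n) < f (j - 1)}"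
    by (rule bij_betw_same_card[of Suc], rule bij_betwI[of _ _ _ "\<lambda>j. j - 1"]) auto
  then show ?case using Suc
    by (cases "m \<le> Suc n") (simp_all add: word_31_2_snoc npairs_map_upt del: upt_Suc add: upt_Suc_append)
qed

lemma word_2_13_map_upt:
  assumes "f (Suc n) = N" "m \<le> Suc n"
  shows "word_2_13 N (map f [m..<Suc n]) =
    (\<Sum>i=m..n. card {j. i < j \<and> j \<le> n \<and> f j < f i \<and> f i < f (j + 1)})"
  using assms(2)
proof (induction rule: inc_induct)
  case base
  show ?case by simp
next
  case (step m)
  then have "map f [m..<Suc n] = f m # map f [Suc m..<Suc n]" by (simp add: upt_conv_Cons del: upt_Suc)
  moreover have "map f [Suc m..<Suc n] @ [N] = map f [Suc m..<Suc (Suc n)]"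
    using step assms(1) by simp
  moreover have "{j. Suc m \<le> j \<and> Suc j < Suc (Suc n) \<and> f j < f m \<and> f m < f (Suc j)}
     = {j. m < j \<and> j \<le> n \<and> f j < f m \<and> f m < f (j + 1)}" by auto
  moreover have "{m..n} = insert m {Suc m..n}" using step by auto
  ultimately show ?case using step
    by (simp add: npairs_map_upt del: upt_Suc)
qed

lemma word_avoids_321_map_upt:
  "word_avoids_321 (map f [m..<n]) \<longleftrightarrow>
    \<not> (\<exists>i j k. m \<le> i \<and> i < j \<and> j < k \<and> k < n \<and> f i > f j \<and> f j > f k)"
proof (cases "m \<le> n")
  case True
  then show ?thesis
  proof (induction rule: inc_induct)
    case base
    then show ?case by simp
  next
    case (step m)
    have "sorted_wrt P (map f [Suc m..<n]) \<longleftrightarrow> (\<forall>j k. m < j \<and> j < k \<and> k < n \<longrightarrow> P (f j) (f k))" for P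
    proof
      assume *: "sorted_wrt P (map f [Suc m..<n])"
      show "\<forall>j k. m < j \<and> j < k \<and> k < n \<longrightarrow> P (f j) (f k)"
      proof (intro allI impI)
        fix j k assume "m < j \<and> j < k \<and> k < n"
        then show "P (f j) (f k)"
          using *[unfolded sorted_wrt_iff_nth_less, rule_format, of "j - Suc m" "k - Suc m"] by auto
      qed
    qed (auto simp: sorted_wrt_iff_nth_less)
    then have av: "word_avoids_321 (map f [m..<n]) \<longleftrightarrow>
        (\<forall>j k. m < j \<and> j < k \<and> k < n \<longrightarrow> \<not> (f j < f m \<and> f k < f j)) \<and>
        \<not> (\<exists>i j k. Suc m \<le> i \<and> i < j \<and> j < k \<and> k < n \<and> f i > f j \<and> f j > f k)"
      using step by (simp add: upt_conv_Cons)
    have "(\<exists>i. m \<le> i \<and> Q i) \<longleftrightarrow> Q m \<or> (\<exists>i. Suc m \<le> i \<and> Q i)" for Q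
      by (metis Suc_leD Suc_leI le_neq_implies_less order_refl)
    from this[of "\<lambda>i. \<exists>j k. i < j \<and> j < k \<and> k < n \<and> f i > f j \<and> f j > f k"]
    show ?case unfolding av by auto
  qed
qed auto

subsection \<open>Partial permutations with gaps\<close>

text \<open>The words obtained from 321-avoiding permutations by deleting all letters above \<open>v\<close> and
  marking each of the \<open>h\<close> gaps that still have a letter to their right by a letter \<open>N > v\<close>, which
  acts as infinity. The final \<open>N\<close> in the gap condition forbids a marker at the end.\<close>

definition configs :: "nat \<Rightarrow> nat \<Rightarrow> nat \<Rightarrow> nat list set" where
  "configs N v h = {w. mset w = mset_set {1..v} + replicate_mset h N \<and>
     successively (\<lambda>x y. x \<noteq> N \<or> y \<noteq> N) (w @ [N]) \<and> word_avoids_321 w}"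

text \<open>The letter extends the initial block, which may be empty, and the first gap stays
  open.\<close>

definition insert_before :: "nat \<Rightarrow> nat \<Rightarrow> nat list \<Rightarrow> nat list" where
  "insert_before N v w = takeWhile (\<lambda>x. x \<noteq> N) w @ v # dropWhile (\<lambda>x. x \<noteq> N) w"

text \<open>The letter consumes the first marker, gluing the initial block to the next one.\<close>

definition replace_first :: "nat \<Rightarrow> nat \<Rightarrow> nat list \<Rightarrow> nat list" where
  "replace_first N v w = takeWhile (\<lambda>x. x \<noteq> N) w @ v # tl (dropWhile (\<lambda>x. x \<noteq> N) w)"

lemma insert_before_eq: "N \<notin> set x \<Longrightarrow> insert_before N v (x @ N # y) = x @ v # N # y"
  unfolding insert_before_def
  by (subst takeWhile_append2, force, subst dropWhile_append2, force) simp

lemma replace_first_eq: "N \<notin> set x \<Longrightarrow> replace_first N v (x @ N # y) = x @ v # y"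
  unfolding replace_first_def
  by (subst takeWhile_append2, force, subst dropWhile_append2, force) simp

lemma mset_set_Suc: "mset_set {Suc 0..Suc v} = add_mset (Suc v) (mset_set {Suc 0..v})"
  by (simp add: atLeastAtMostSuc_conv)

lemma configs_letters:
  assumes "w \<in> configs N v h" "u \<in> set w"
  shows "u \<le> v \<or> u = N"
proof -
  have "u \<in># mset w" using assms by simp
  also have "mset w = mset_set {1..v} + replicate_mset h N" using assms by (simp add: configs_def)
  finally show ?thesis by (auto split: if_splits)
qed

lemma configs_count:
  assumes "w \<in> configs N v h" "v < N"
  shows "count_list w N = h"
proof -
  have "count (mset w) N = h" using assms by (auto simp: configs_def)
  then show ?thesis by (simp add: count_mset)
qed

text \<open>A nonempty word of markers alone ends in a marker, against the gap condition.\<close>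

lemma configs_0: "configs N 0 h = (if h = 0 then {[]} else {})"
proof -
  have "\<not> successively (\<lambda>x y. x \<noteq> N \<or> y \<noteq> N) (w @ [N])" if "mset w = replicate_mset h N" "h > 0" for w
  proof -
    have "set_mset (mset w) = {N}" unfolding that(1) using that(2) by (cases h) auto
    then have "set w = {N}" by simp
    then have "w \<noteq> []" "last w = N" using last_in_set[of w] by fastforce+
    then show ?thesis by (simp add: successively_append_iff)
  qed
  then show ?thesis by (auto simp: configs_def)
qed

lemma configs_split:
  assumes "w \<in> configs N v (Suc h)" "v < N"
  obtains x y where "w = x @ N # y" "N \<notin> set x" "y \<noteq> []" "hd y \<noteq> N"
proof -
  have "N \<in># mset w" using assms by (auto simp: configs_def)
  then obtain x y where xy: "w = x @ N # y" "N \<notin> set x"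
    by (auto dest: split_list_first)
  have "y \<noteq> [] \<and> hd y \<noteq> N" using assms(1) unfolding configs_def xy
    by (cases y) (auto simp: successively_append_iff)
  with xy that show ?thesis by blast
qed

text \<open>At the end \<open>v\<close> could only play the 1, below two distinct larger letters,
  but only \<open>N\<close> is larger.\<close>

lemma word_avoids_321_append_max:
  assumes "\<forall>u\<in>set w. u < v \<or> u = N" "v < N"
  shows "word_avoids_321 (w @ [v]) \<longleftrightarrow> word_avoids_321 w"
    "word_avoids_321 (w @ [N, v]) \<longleftrightarrow> word_avoids_321 w"
  using assms by (induction w) (auto simp: sorted_wrt_append)

text \<open>Only letters strictly below the leading one matter, and below \<open>v\<close> as below
  \<open>N\<close> these are exactly the letters of \<open>y\<close> other than
  \<open>N\<close>.\<close>

lemma word_avoids_321_Cons_max: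
  assumes "\<forall>u\<in>set y. u < v \<or> u = N" "v < N"
  shows "word_avoids_321 (v # y) \<longleftrightarrow> word_avoids_321 (N # y)"
proof -
  have "sorted_wrt (\<lambda>a b. \<not> (a < v \<and> b < a)) y \<longleftrightarrow> sorted_wrt (\<lambda>a b. \<not> (a < N \<and> b < a)) y"
    using assms by (induction y) auto
  then show ?thesis by simp
qed

text \<open>With only smaller letters before it, \<open>v\<close> can only play the 3, and there the
  adjacent \<open>N\<close> can take its place.\<close>

lemma word_avoids_321_insert_before:
  assumes "\<forall>u\<in>set x. u < v" "\<forall>u\<in>set y. u < v \<or> u = N" "v < N"
  shows "word_avoids_321 (x @ v # N # y) \<longleftrightarrow> word_avoids_321 (x @ N # y)"
  using assms(1)
proof (induction x)
  case Nil
  have "word_avoids_321 (v # N # y) \<longleftrightarrow> word_avoids_321 (N # y) \<and> sorted_wrt (\<lambda>a b. \<not> (a < v \<and> b < a)) y"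
    using assms by auto
  also have "\<dots> \<longleftrightarrow> word_avoids_321 (N # y)"
    using word_avoids_321_Cons_max[OF assms(2,3)] by auto
  finally show ?case by simp
next
  case (Cons a x)
  then show ?case using assms by (auto simp: sorted_wrt_append)
qed

lemma word_avoids_321_replace_first:
  assumes "\<forall>u\<in>set x. u < v" "\<forall>u\<in>set y. u < v \<or> u = N" "v < N"
  shows "word_avoids_321 (x @ v # y) \<longleftrightarrow> word_avoids_321 (x @ N # y)"
  using assms(1)
proof (induction x)
  case Nil
  show ?case using word_avoids_321_Cons_max[OF assms(2,3)] by simp
next
  case (Cons a x)
  then show ?case using assms by (auto simp: sorted_wrt_append)
qed

text \<open>Otherwise \<open>N\<close>, \<open>v\<close>, \<open>u\<close> would form a 321.\<close>

lemma word_avoids_321_middle: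
  assumes "word_avoids_321 (x @ v # y)" "N \<in> set x" "v < N" "u \<in> set y"
  shows "v \<le> u"
  using assms by (induction x) (auto simp: sorted_wrt_append)

text \<open>If the largest letter \<open>v + 1\<close> is not the last one, then the word continues with a smaller
  letter somewhere after it, so that avoiding 321 excludes every marker \<open>N\<close> to its left. Hence
  \<open>v + 1\<close> is either last or adjacent to the initial block.\<close>

lemma configs_Suc_subset:
  assumes vN: "Suc v < N" and w: "w \<in> configs N (Suc v) h"
  shows "w \<in> (\<lambda>w. w @ [Suc v]) ` configs N v h
      \<or> (\<exists>k. h = Suc k \<and> w \<in> (\<lambda>w. w @ [N, Suc v]) ` configs N v k)
      \<or> (h \<noteq> 0 \<and> w \<in> insert_before N (Suc v) ` configs N v h)
      \<or> w \<in> replace_first N (Suc v) ` configs N v (Suc h)"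
proof -
  have m: "mset w = add_mset (Suc v) (mset_set {Suc 0..v} + replicate_mset h N)"
    using w by (simp add: configs_def mset_set_Suc)
  then have "Suc v \<in> set w" by (metis set_mset_mset union_single_eq_member)
  then obtain x y where xy: "w = x @ Suc v # y" by (auto dest: split_list)
  have m': "mset (x @ y) = mset_set {Suc 0..v} + replicate_mset h N"
    using m unfolding xy by simp
  have lt: "u < Suc v \<or> u = N" if "u \<in> set (x @ y)" for u
  proof -
    have "u \<in># mset (x @ y)" using that by simp
    then show ?thesis unfolding m' by (auto split: if_splits)
  qed
  have gap: "successively (\<lambda>x y. x \<noteq> N \<or> y \<noteq> N) (x @ Suc v # y @ [N])"
    and av: "word_avoids_321 (x @ Suc v # y)"
    using w by (simp_all add: configs_def xy)
  show ?thesis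
  \<comment> \<open>The neighbours of \<open>Suc v\<close> reveal the insertion: it is last, with or
    without a marker before it, or it is followed by a marker or by a smaller letter.\<close>
  proof (cases "y = []")
    case True
    then have avx: "word_avoids_321 x"
      using av word_avoids_321_append_max(1)[of x "Suc v" N] lt vN by auto
    show ?thesis
    proof (cases "x \<noteq> [] \<and> last x = N")
      case True
      then obtain x' where x': "x = x' @ [N]" by (metis append_butlast_last_id)
      have "N \<in># mset (x @ y)" using x' by simp
      then have "h \<noteq> 0" unfolding m' using vN by (auto split: if_splits)
      then obtain k where k: "h = Suc k" by (cases h) auto
      have "mset x' = mset_set {Suc 0..v} + replicate_mset k N"
        using m' unfolding x' k \<open>y = []\<close> by simp
      moreover have "word_avoids_321 x'"
        using avx unfolding x'
        by (induction x') (auto simp: sorted_wrt_append)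
      moreover have "successively (\<lambda>x y. x \<noteq> N \<or> y \<noteq> N) (x' @ [N])"
        using gap by (auto simp: x' successively_append_iff)
      ultimately have "x' \<in> configs N v k" by (simp add: configs_def)
      then show ?thesis using k unfolding xy x' \<open>y = []\<close> by auto
    next
      case False
      then have "successively (\<lambda>x y. x \<noteq> N \<or> y \<noteq> N) (x @ [N])"
        using gap by (auto simp: successively_append_iff)
      then have "x \<in> configs N v h" using m' avx \<open>y = []\<close> by (simp add: configs_def)
      then show ?thesis unfolding xy \<open>y = []\<close> by auto
    qed
  next
    case False
    then obtain b z where y: "y = b # z" by (cases y) auto
    have Nx: "N \<notin> set x"
    proof
      assume "N \<in> set x"
      \<comment> \<open>Everything after \<open>Suc v\<close> would be a marker, yet no marker may
        be last.\<close>
      then have *: "u = N" if "u \<in> set y" for u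
        using word_avoids_321_middle[OF av, of N u] vN lt[of u] that by auto
      then have "last y = N" using False by simp
      then show False using gap False
        by (auto simp: successively_append_iff successively_Cons)
    qed
    have ltx: "\<forall>u\<in>set x. u < Suc v" using lt Nx by auto
    have lty: "\<forall>u\<in>set y. u < Suc v \<or> u = N" using lt by auto
    show ?thesis
    proof (cases "b = N")
      case True
      have "N \<in># mset (x @ y)" using True y by simp
      then have "h \<noteq> 0" unfolding m' using vN by (auto split: if_splits)
      have "x @ y \<in> configs N v h"
      proof -
        have "word_avoids_321 (x @ y)"
          using av word_avoids_321_insert_before[of x "Suc v" z N] ltx lty vN True y by auto
        moreover have "x = [] \<or> last x \<noteq> N" using Nx last_in_set by metis
        then have "successively (\<lambda>x y. x \<noteq> N \<or> y \<noteq> N) (x @ y @ [N])"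
          using gap y True by (auto simp: successively_append_iff)
        ultimately show ?thesis using m' by (simp add: configs_def)
      qed
      moreover have "w = insert_before N (Suc v) (x @ y)"
        using insert_before_eq[OF Nx] unfolding xy y True by simp
      ultimately show ?thesis using \<open>h \<noteq> 0\<close> by blast
    next
      case bN: False
      have "x @ N # y \<in> configs N v (Suc h)"
      proof -
        have "word_avoids_321 (x @ N # y)"
          using av word_avoids_321_replace_first[of x "Suc v" y N] ltx lty vN by auto
        moreover have "x = [] \<or> last x \<noteq> N" using Nx last_in_set by metis
        then have "successively (\<lambda>x y. x \<noteq> N \<or> y \<noteq> N) (x @ N # y @ [N])"
          using gap y bN by (auto simp: successively_append_iff)
        ultimately show ?thesis using m' by (simp add: configs_def)
      qed
      moreover have "w = replace_first N (Suc v) (x @ N # y)"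
        using replace_first_eq[OF Nx] unfolding xy by simp
      ultimately show ?thesis by blast
    qed
  qed
qed

lemma append_in_configs:
  assumes vN: "Suc v < N" and w: "w \<in> configs N v h"
  shows "w @ [Suc v] \<in> configs N (Suc v) h" "w @ [N, Suc v] \<in> configs N (Suc v) (Suc h)"
proof -
  have "\<forall>u\<in>set w. u < Suc v \<or> u = N" using configs_letters[OF w] le_imp_less_Suc by blast
  note av = word_avoids_321_append_max[OF this vN]
  show "w @ [Suc v] \<in> configs N (Suc v) h" "w @ [N, Suc v] \<in> configs N (Suc v) (Suc h)"
    using w vN by (auto simp: configs_def av mset_set_Suc successively_append_iff)
qed

lemma insert_before_in_configs:
  assumes vN: "Suc v < N" and w: "w \<in> configs N v (Suc h)"
  shows "insert_before N (Suc v) w \<in> configs N (Suc v) (Suc h)"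
proof -
  obtain x y where xy: "w = x @ N # y" "N \<notin> set x" "y \<noteq> []" "hd y \<noteq> N"
    using configs_split[OF w] vN by auto
  have lt: "u < Suc v \<or> u = N" if "u \<in> set w" for u using configs_letters[OF w that] by auto
  then have "word_avoids_321 (x @ Suc v # N # y)"
    using word_avoids_321_insert_before[of x "Suc v" y N] w xy vN by (fastforce simp: configs_def)
  then show ?thesis
    using w vN unfolding xy(1) insert_before_eq[OF xy(2)]
    by (auto simp: configs_def mset_set_Suc successively_append_iff)
qed

lemma replace_first_in_configs:
  assumes vN: "Suc v < N" and w: "w \<in> configs N v (Suc h)"
  shows "replace_first N (Suc v) w \<in> configs N (Suc v) h"
proof -
  obtain x y where xy: "w = x @ N # y" "N \<notin> set x" "y \<noteq> []" "hd y \<noteq> N"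
    using configs_split[OF w] vN by auto
  have lt: "u < Suc v \<or> u = N" if "u \<in> set w" for u using configs_letters[OF w that] by auto
  then have "word_avoids_321 (x @ Suc v # y)"
    using word_avoids_321_replace_first[of x "Suc v" y N] w xy vN by (fastforce simp: configs_def)
  then show ?thesis
    using w vN unfolding xy(1) replace_first_eq[OF xy(2)]
    by (auto simp: configs_def mset_set_Suc successively_append_iff successively_Cons)
qed

lemma configs_Suc:
  assumes "Suc v < N"
  shows "configs N (Suc v) h =
      (\<lambda>w. w @ [Suc v]) ` configs N v h
      \<union> (case h of 0 \<Rightarrow> {} | Suc k \<Rightarrow> (\<lambda>w. w @ [N, Suc v]) ` configs N v k)
      \<union> (if h = 0 then {} else insert_before N (Suc v) ` configs N v h)
      \<union> replace_first N (Suc v) ` configs N v (Suc h)"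
proof (intro equalityI subsetI)
  fix w assume "w \<in> configs N (Suc v) h"
  from configs_Suc_subset[OF assms this] show "w \<in> (\<lambda>w. w @ [Suc v]) ` configs N v h
      \<union> (case h of 0 \<Rightarrow> {} | Suc k \<Rightarrow> (\<lambda>w. w @ [N, Suc v]) ` configs N v k)
      \<union> (if h = 0 then {} else insert_before N (Suc v) ` configs N v h)
      \<union> replace_first N (Suc v) ` configs N v (Suc h)" by auto
next
  fix w assume "w \<in> (\<lambda>w. w @ [Suc v]) ` configs N v h
      \<union> (case h of 0 \<Rightarrow> {} | Suc k \<Rightarrow> (\<lambda>w. w @ [N, Suc v]) ` configs N v k)
      \<union> (if h = 0 then {} else insert_before N (Suc v) ` configs N v h)
      \<union> replace_first N (Suc v) ` configs N v (Suc h)"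
  then show "w \<in> configs N (Suc v) h"
    using append_in_configs[OF assms] insert_before_in_configs[OF assms] replace_first_in_configs[OF assms]
    by (cases h) auto
qed

lemma finite_configs: "finite (configs N v h)"
proof -
  have "configs N v h \<subseteq> {w. mset w = mset_set {1..v} + replicate_mset h N}"
    by (auto simp: configs_def)
  then show ?thesis using finite_subset[OF _ mset_eq_finite] ex_mset by metis
qed

subsection \<open>Effect of an insertion on the statistics\<close>

text \<open>By the gap condition each marker is followed by a smaller letter, and only these
  descents cross \<open>v\<close>.\<close>

lemma npairs_crossing_descents:
  fixes v N :: nat
  assumes "successively (\<lambda>x y. x \<noteq> N \<or> y \<noteq> N) (w @ [N])" "\<forall>u\<in>set w. u < v \<or> u = N" "v < N"
  shows "npairs (\<lambda>x y. y < v \<and> v < x) w = count_list w N"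
  using assms
proof (induction w rule: induct_list012)
  case (3 x y w)
  then show ?case by auto
qed auto

lemma npairs_crossing_top:
  fixes N :: nat
  assumes "\<forall>u\<in>set w. u \<le> N"
  shows "npairs (\<lambda>x y. x < N \<and> N < y) w = 0" "npairs (\<lambda>x y. y < N \<and> N < x) w = 0"
  using assms by (induction w rule: induct_list012) auto


text \<open>\<open>v\<close> sits between ascents and nothing larger precedes it, so it takes part
  in no 31-2.\<close>

lemma word_31_2_insert_before:
  assumes "\<forall>u\<in>set x. u < v" "v < N"
  shows "word_31_2 (x @ v # N # y) = word_31_2 (x @ N # y)"
  using assms
proof (induction x rule: induct_list012)
  case 1
  have "filter (\<lambda>u. N < u \<and> u < v) y = []" using assms by (auto simp: filter_empty_conv)
  then show ?case by simp
next
  case (2 a)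
  then have "filter (\<lambda>u. N < u \<and> u < v) y = []" "filter (\<lambda>u. v < u \<and> u < a) y = []"
    "filter (\<lambda>u. N < u \<and> u < a) y = []" by (auto simp: filter_empty_conv)
  then show ?case using 2 by simp
next
  case (3 a b x)
  then show ?case by auto
qed

lemma word_31_2_Cons_max:
  assumes "\<forall>u\<in>set y. u < v \<or> u = N" "v < N"
  shows "word_31_2 (v # y) = word_31_2 (N # y)"
proof (cases y)
  case (Cons b r)
  have "filter (\<lambda>u. b < u \<and> u < v) r = filter (\<lambda>u. b < u \<and> u < N) r"
    using assms Cons by (intro filter_cong) auto
  then show ?thesis using Cons by simp
qed simp

lemma word_31_2_replace_first:
  assumes "\<forall>u\<in>set x. u < v" "\<forall>u\<in>set y. u < v \<or> u = N" "v < N"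
  shows "word_31_2 (x @ v # y) = word_31_2 (x @ N # y)"
  using assms
proof (induction x rule: induct_list012)
  case 1
  then show ?case by (simp add: word_31_2_Cons_max)
next
  case (2 a)
  then have "filter (\<lambda>u. v < u \<and> u < a) y = []" "filter (\<lambda>u. N < u \<and> u < a) y = []"
    by (auto simp: filter_empty_conv)
  then show ?case using 2 by (simp add: word_31_2_Cons_max)
next
  case (3 a b x)
  then show ?case by auto
qed

lemma npairs_des_insert_before:
  fixes v N :: nat
  assumes "\<forall>u\<in>set x. u < v" "v < N"
  shows "npairs (\<lambda>x y. y < x) (x @ v # N # y) = npairs (\<lambda>x y. y < x) (x @ N # y)"
  using assms by (induction x rule: induct_list012) auto

lemma npairs_des_replace_first:
  fixes v N :: nat
  assumes "\<forall>u\<in>set x. u < v" "v < N" "y \<noteq> []" "hd y < v"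
  shows "npairs (\<lambda>x y. y < x) (x @ v # y) = npairs (\<lambda>x y. y < x) (x @ N # y)"
  using assms by (induction x rule: induct_list012) (auto simp: neq_Nil_conv)

text \<open>Earlier letters other than \<open>N\<close> lie below both \<open>v\<close> and
  \<open>N\<close>, so an ascent into either counts alike; as a 2, \<open>v\<close> has only the
  closing \<open>N\<close> behind it.\<close>

lemma word_2_13_append:
  assumes "\<forall>u\<in>set w. u < v \<or> u = N" "v < N"
  shows "word_2_13 N (w @ [v]) = word_2_13 N w" "word_2_13 N (w @ [N, v]) = word_2_13 N w"
proof -
  have A: "npairs (\<lambda>x y. x < u \<and> u < y) (r @ [v, N]) = npairs (\<lambda>x y. x < u \<and> u < y) (r @ [N])"
    and B: "npairs (\<lambda>x y. x < u \<and> u < y) (r @ [N, v, N]) = npairs (\<lambda>x y. x < u \<and> u < y) (r @ [N])"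
    if "u < v \<or> u = N" "\<forall>a\<in>set r. a < v \<or> a = N" for r u
    using that(2) that(1) assms(2) by (induction r rule: induct_list012) auto
  show "word_2_13 N (w @ [v]) = word_2_13 N w" "word_2_13 N (w @ [N, v]) = word_2_13 N w"
    using assms by (induction w) (auto simp: A B)
qed

text \<open>Letters of \<open>x\<close> cannot tell an ascent into \<open>v\<close> from one into
  \<open>N\<close>, so the only new contribution is that of \<open>v\<close> as the 2.\<close>

lemma word_2_13_insert_before:
  assumes "\<forall>u\<in>set x. u < v" "v < N"
  shows "word_2_13 N (x @ v # N # y) =
    word_2_13 N (x @ N # y) + npairs (\<lambda>x y. x < v \<and> v < y) (y @ [N])"
proof -
  have A: "npairs (\<lambda>x y. x < u \<and> u < y) (r @ v # N # y @ [N]) = npairs (\<lambda>x y. x < u \<and> u < y) (r @ N # y @ [N])"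
    if "u < v" "\<forall>a\<in>set r. a < v" for r u
    using that(2) that(1) assms(2) by (induction r rule: induct_list012) auto
  have B: "npairs (\<lambda>x y. x < v \<and> v < y) (N # y @ [N]) = npairs (\<lambda>x y. x < v \<and> v < y) (y @ [N])"
    using assms(2) by (cases y) auto
  show ?thesis
    using assms by (induction x) (auto simp: A B)
qed

lemma word_2_13_replace_first:
  assumes "\<forall>u\<in>set x. u < v" "\<forall>u\<in>set y. u < v \<or> u = N" "v < N"
  shows "word_2_13 N (x @ v # y) =
    word_2_13 N (x @ N # y) + npairs (\<lambda>x y. x < v \<and> v < y) (y @ [N])"
proof -
  have A: "npairs (\<lambda>x y. x < u \<and> u < y) (r @ v # y @ [N]) = npairs (\<lambda>x y. x < u \<and> u < y) (r @ N # y @ [N])"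
    if "u < v" "\<forall>a\<in>set r. a < v" for r u
    using that(2) that(1) assms(3)
  proof (induction r rule: induct_list012)
    case 1
    then show ?case by (cases y) auto
  next
    case (2 a)
    then show ?case by (cases y) auto
  qed auto
  have "\<forall>u\<in>set (y @ [N]). u \<le> N" using assms by auto
  note B = npairs_crossing_top(1)[OF this]
  show ?thesis
    using assms(1) by (induction x) (auto simp: A B)
qed

text \<open>Each \<open>N\<close> in \<open>y @ [N]\<close> follows a letter below \<open>v\<close>,
  and only these ascents cross \<open>v\<close>; the \<open>Suc\<close> is the closing
  \<open>N\<close>.\<close>

lemma npairs_crossing_ascents:
  fixes v N :: nat
  assumes "successively (\<lambda>x y. x \<noteq> N \<or> y \<noteq> N) (y @ [N])" "y \<noteq> []" "hd y \<noteq> N"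
    "\<forall>u\<in>set y. u < v \<or> u = N" "v < N"
  shows "npairs (\<lambda>x y. x < v \<and> v < y) (y @ [N]) = Suc (count_list y N)"
proof -
  \<comment> \<open>Tails met in the induction may start with a marker, which no ascent reaches;
    hence the correction term.\<close>
  have "npairs (\<lambda>x y. x < v \<and> v < y) (z @ [N]) = count_list (z @ [N]) N - of_bool (hd (z @ [N]) = N)"
    if "successively (\<lambda>x y. x \<noteq> N \<or> y \<noteq> N) (z @ [N])" "\<forall>u\<in>set z. u < v \<or> u = N" for z
    using that assms(5)
    by (induction z rule: induct_list012) (auto simp: hd_append neq_Nil_conv)
  from this[OF assms(1,4)] assms(2,3) show ?thesis by simp
qed

section \<open>Change of the weight under the four insertions\<close>

definition weight :: "'a::comm_ring_1 \<Rightarrow> 'a \<Rightarrow> 'a \<Rightarrow> nat \<Rightarrow> nat list \<Rightarrow> 'a" where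
  "weight p q t N w = p ^ word_2_13 N w * q ^ word_31_2 w * t ^ npairs (\<lambda>x y. y < x) w"

text \<open>As a final letter, \<open>Suc v\<close> is the 2 for the descent out of each of the
  \<open>h\<close> markers, hence \<open>q ^ h\<close>. A new marker before it creates one descent,
  hence \<open>t\<close>.\<close>

lemma weight_append:
  assumes vN: "Suc v < N" and w: "w \<in> configs N v h"
  shows "weight p q t N (w @ [Suc v]) = q ^ h * weight p q t N w"
    "weight p q t N (w @ [N, Suc v]) = t * q ^ h * weight p q t N w"
proof -
  have lt: "\<forall>u\<in>set w. u < Suc v \<or> u = N" using configs_letters[OF w] le_imp_less_Suc by blast
  have gap: "successively (\<lambda>x y. x \<noteq> N \<or> y \<noteq> N) (w @ [N])" using w by (simp add: configs_def)
  have c: "npairs (\<lambda>x y. y < Suc v \<and> Suc v < x) w = h"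
    using npairs_crossing_descents[OF gap lt vN] configs_count[OF w] vN by simp
  have "\<forall>u\<in>set w. u \<le> N" using lt vN by auto
  note c' = npairs_crossing_top(2)[OF this]
  have last: "w = [] \<or> last w < Suc v"
    using lt gap last_in_set[of w] by (fastforce simp: successively_append_iff)
  have d1: "npairs (\<lambda>x y. y < x) (w @ [Suc v]) = npairs (\<lambda>x y. y < x) w"
    using last by (auto simp: npairs_snoc)
  have d2: "npairs (\<lambda>x y. y < x) (w @ [N, Suc v]) = Suc (npairs (\<lambda>x y. y < x) w)"
    using last vN npairs_snoc[of "\<lambda>x y. y < x" "w @ [N]" "Suc v"] by (auto simp: npairs_snoc)
  \<comment> \<open>The new marker is reached by an ascent, and the descent out of it ends in
    \<open>Suc v\<close> itself, so neither pair crosses \<open>Suc v\<close>.\<close>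
  have "npairs (\<lambda>x y. y < Suc v \<and> Suc v < x) (w @ [N]) = h"
    using c last vN by (auto simp: npairs_snoc)
  then have s: "word_31_2 (w @ [N, Suc v]) = word_31_2 w + h"
    using word_31_2_snoc[of "w @ [N]" "Suc v"] by (simp add: word_31_2_snoc c')
  show "weight p q t N (w @ [Suc v]) = q ^ h * weight p q t N w"
    "weight p q t N (w @ [N, Suc v]) = t * q ^ h * weight p q t N w"
    by (simp_all add: weight_def word_2_13_append[OF lt vN] word_31_2_snoc c d1 d2 s power_add mult_ac)
qed

text \<open>\<open>Suc v\<close> is the 2 for the ascents into the \<open>h\<close> markers of
  \<open>y\<close> and into the closing \<open>N\<close>, hence \<open>p ^ Suc h\<close>.\<close>

lemma weight_insert_replace:
  assumes vN: "Suc v < N" and w: "w \<in> configs N v (Suc h)"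
  shows "weight p q t N (insert_before N (Suc v) w) = p ^ Suc h * weight p q t N w"
    "weight p q t N (replace_first N (Suc v) w) = p ^ Suc h * weight p q t N w"
proof -
  obtain x y where xy: "w = x @ N # y" "N \<notin> set x" "y \<noteq> []" "hd y \<noteq> N"
    using configs_split[OF w] vN by auto
  have lt: "u < Suc v \<or> u = N" if "u \<in> set w" for u using configs_letters[OF w that] by auto
  have ltx: "\<forall>u\<in>set x. u < Suc v" and lty: "\<forall>u\<in>set y. u < Suc v \<or> u = N"
    using lt xy by auto
  have hd: "hd y < Suc v" using lty xy hd_in_set[of y] by auto
  have "successively (\<lambda>x y. x \<noteq> N \<or> y \<noteq> N) (y @ [N])"
    using w by (auto simp: configs_def xy successively_append_iff successively_Cons)
  from npairs_crossing_ascents[OF this xy(3,4) lty vN]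
  have c: "npairs (\<lambda>x y. x < Suc v \<and> Suc v < y) (y @ [N]) = Suc h"
    using configs_count[OF w] vN xy by simp
  show "weight p q t N (insert_before N (Suc v) w) = p ^ Suc h * weight p q t N w"
    unfolding xy(1) insert_before_eq[OF xy(2)] weight_def word_2_13_insert_before[OF ltx vN]
      word_31_2_insert_before[OF ltx vN] npairs_des_insert_before[OF ltx vN] c
    by (simp add: power_add mult_ac)
  show "weight p q t N (replace_first N (Suc v) w) = p ^ Suc h * weight p q t N w"
    unfolding xy(1) replace_first_eq[OF xy(2)] weight_def word_2_13_replace_first[OF ltx lty vN]
      word_31_2_replace_first[OF ltx lty vN] npairs_des_replace_first[OF ltx vN xy(3) hd] c
    by (simp add: power_add mult_ac)
qed

section \<open>Injectivity and disjointness of the insertions, and the recurrence\<close>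

lemma configs_not_mem: "Suc v < N \<Longrightarrow> w \<in> configs N v h \<Longrightarrow> Suc v \<notin> set w"
  using configs_letters by fastforce

text \<open>The inserted letter is new, so its place determines \<open>x\<close> and
  \<open>y\<close>.\<close>

lemma inj_insert_before:
  assumes "Suc v < N"
  shows "inj_on (insert_before N (Suc v)) (configs N v (Suc h))"
proof (rule inj_onI)
  fix w w' assume w: "w \<in> configs N v (Suc h)" "w' \<in> configs N v (Suc h)"
    and eq: "insert_before N (Suc v) w = insert_before N (Suc v) w'"
  obtain x y where xy: "w = x @ N # y" "N \<notin> set x" using configs_split[OF w(1)] Suc_lessD[OF assms] by blast
  obtain x' y' where xy': "w' = x' @ N # y'" "N \<notin> set x'" using configs_split[OF w(2)] Suc_lessD[OF assms] by blast
  have "Suc v \<notin> set w" "Suc v \<notin> set w'" using configs_not_mem assms w by blast+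
  then show "w = w'" using eq unfolding xy(1) xy'(1) insert_before_eq[OF xy(2)] insert_before_eq[OF xy'(2)]
    by (auto simp: append_Cons_eq_iff)
qed

lemma inj_replace_first:
  assumes "Suc v < N"
  shows "inj_on (replace_first N (Suc v)) (configs N v (Suc h))"
proof (rule inj_onI)
  fix w w' assume w: "w \<in> configs N v (Suc h)" "w' \<in> configs N v (Suc h)"
    and eq: "replace_first N (Suc v) w = replace_first N (Suc v) w'"
  obtain x y where xy: "w = x @ N # y" "N \<notin> set x" using configs_split[OF w(1)] Suc_lessD[OF assms] by blast
  obtain x' y' where xy': "w' = x' @ N # y'" "N \<notin> set x'" using configs_split[OF w(2)] Suc_lessD[OF assms] by blast
  have "Suc v \<notin> set w" "Suc v \<notin> set w'" using configs_not_mem assms w by blast+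
  then show "w = w'" using eq unfolding xy(1) xy'(1) replace_first_eq[OF xy(2)] replace_first_eq[OF xy'(2)]
    by (auto simp: append_Cons_eq_iff)
qed

text \<open>The new letter is followed by a marker in the first word and by another letter in the
  second.\<close>

lemma insert_before_neq_replace_first:
  assumes vN: "Suc v < N" and w: "w \<in> configs N v (Suc h)" "w' \<in> configs N v (Suc h')"
  shows "insert_before N (Suc v) w \<noteq> replace_first N (Suc v) w'"
proof
  assume eq: "insert_before N (Suc v) w = replace_first N (Suc v) w'"
  obtain x y where xy: "w = x @ N # y" "N \<notin> set x" using configs_split[OF w(1)] Suc_lessD[OF vN] by blast
  obtain x' y' where xy': "w' = x' @ N # y'" "N \<notin> set x'" "y' \<noteq> []" "hd y' \<noteq> N"
    using configs_split[OF w(2)] vN by auto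
  have "Suc v \<notin> set w" "Suc v \<notin> set w'" using configs_not_mem vN w by blast+
  then have "y' = N # y" using eq unfolding xy(1) xy'(1) insert_before_eq[OF xy(2)] replace_first_eq[OF xy'(2)]
    by (auto simp: append_Cons_eq_iff)
  then show False using xy' by simp
qed

text \<open>Separates these two insertions from the two that append: the nonempty rest
  \<open>y\<close> stays behind the new letter.\<close>

lemma last_insert_replace:
  assumes vN: "Suc v < N" and w: "w \<in> configs N v (Suc h)"
  shows "last (insert_before N (Suc v) w) \<noteq> Suc v" "last (replace_first N (Suc v) w) \<noteq> Suc v"
proof -
  obtain x y where xy: "w = x @ N # y" "N \<notin> set x" "y \<noteq> []" "hd y \<noteq> N"
    using configs_split[OF w] vN by auto
  have "last y \<in> set w" using last_in_set[OF xy(3)] by (simp add: xy(1))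
  then have "last y \<noteq> Suc v" using configs_not_mem[OF vN w] by metis
  then show "last (insert_before N (Suc v) w) \<noteq> Suc v" "last (replace_first N (Suc v) w) \<noteq> Suc v"
    unfolding xy(1) insert_before_eq[OF xy(2)] replace_first_eq[OF xy(2)]
    using xy(3) by auto
qed

lemma append_neq:
  assumes "w \<in> configs N v h"
  shows "w @ [Suc v] \<noteq> w' @ [N, Suc v]"
proof
  assume "w @ [Suc v] = w' @ [N, Suc v]"
  then have "w = w' @ [N]" by (metis append.assoc append_Cons append_Nil append_same_eq)
  then show False using assms by (auto simp: configs_def successively_append_iff)
qed

text \<open>The insertions are the Motzkin steps. At height 0 there is no gap to insert before, so a
  single level step of weight \<open>q ^ 0\<close> remains; this is why the level weight there is
  1.\<close>

lemma sum_weight_configs: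
  "v < N \<Longrightarrow> (\<Sum>w\<in>configs N v h. weight p q t N w) =
     motzkin_sum (\<lambda>h. if h = 0 then 1 else p ^ h + q ^ h) (\<lambda>h. t * q ^ h) (\<lambda>h. p ^ Suc h) v h"
proof (induction v arbitrary: h)
  case 0
  show ?case by (simp add: configs_0 weight_def)
next
  case (Suc v)
  let ?W = "sum (weight p q t N)"
  let ?A = "(\<lambda>w. w @ [Suc v]) ` configs N v h"
  let ?B = "case h of 0 \<Rightarrow> {} | Suc k \<Rightarrow> (\<lambda>w. w @ [N, Suc v]) ` configs N v k"
  let ?C = "if h = 0 then {} else insert_before N (Suc v) ` configs N v h"
  let ?D = "replace_first N (Suc v) ` configs N v (Suc h)"
  have A: "?W ?A = q ^ h * ?W (configs N v h)"
    by (subst sum.reindex) (auto simp: inj_on_def weight_append[OF Suc.prems] sum_distrib_left)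
  have B: "?W ?B = (case h of 0 \<Rightarrow> 0 | Suc k \<Rightarrow> t * q ^ k * ?W (configs N v k))"
    by (auto split: nat.split simp: sum.reindex inj_on_def weight_append[OF Suc.prems] sum_distrib_left)
  have C: "?W ?C = (if h = 0 then 0 else p ^ h * ?W (configs N v h))"
    by (cases h) (simp_all add: sum.reindex[OF inj_insert_before[OF Suc.prems]]
      weight_insert_replace[OF Suc.prems] sum_distrib_left del: power_Suc)
  have D: "?W ?D = p ^ Suc h * ?W (configs N v (Suc h))"
    by (simp add: sum.reindex[OF inj_replace_first[OF Suc.prems]]
      weight_insert_replace[OF Suc.prems] sum_distrib_left del: power_Suc)
  have fin: "finite ?A" "finite ?B" "finite ?C" "finite ?D"
    by (auto simp: finite_configs split: nat.split)
  have "?A \<inter> ?B = {}" using append_neq by (auto split: nat.split)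
  moreover have "(?A \<union> ?B) \<inter> ?C = {}"
    using last_insert_replace(1)[OF Suc.prems] by (cases h) force+
  moreover have "(?A \<union> ?B \<union> ?C) \<inter> ?D = {}"
  proof -
    have "(?A \<union> ?B) \<inter> ?D = {}"
    proof -
      have "last w = Suc v" if "w \<in> ?A \<union> ?B" for w using that by (auto split: nat.splits)
      moreover have "last w \<noteq> Suc v" if "w \<in> ?D" for w
        using that last_insert_replace(2)[OF Suc.prems] by auto
      ultimately show ?thesis by blast
    qed
    moreover have "?C \<inter> ?D = {}"
      using insert_before_neq_replace_first[OF Suc.prems] by (cases h) auto
    ultimately show ?thesis by blast
  qed
  ultimately have "?W (configs N (Suc v) h) = ?W ?A + ?W ?B + ?W ?C + ?W ?D"
    unfolding configs_Suc[OF Suc.prems] using fin by (simp add: sum.union_disjoint del: Un_assoc)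
  then show ?case using Suc
    unfolding A B C D by (cases h) (simp_all add: algebra_simps)
qed

section \<open>Permutations as configurations without gaps\<close>

lemma perms_321_configs:
  "bij_betw (\<lambda>\<sigma>. map \<sigma> [1..<Suc n]) (perms_321 n) (configs (Suc n) n 0)"
proof (rule bij_betwI')
  fix \<sigma> \<tau> assume *: "\<sigma> \<in> perms_321 n" "\<tau> \<in> perms_321 n"
  show "(map \<sigma> [1..<Suc n] = map \<tau> [1..<Suc n]) = (\<sigma> = \<tau>)"
  proof
    assume eq: "map \<sigma> [1..<Suc n] = map \<tau> [1..<Suc n]"
    show "\<sigma> = \<tau>"
    proof
      fix i show "\<sigma> i = \<tau> i"
      proof (cases "i \<in> {1..n}")
        case True
        then show ?thesis using eq by (auto simp del: upt_Suc)
      next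
        case False
        then show ?thesis using * by (metis (lifting) mem_Collect_eq perms_321_def permutes_not_in)
      qed
    qed
  qed simp
next
  fix \<sigma> assume "\<sigma> \<in> perms_321 n"
  then have p: "\<sigma> permutes {1..n}" and av: "avoids_321 n \<sigma>" by (auto simp: perms_321_def)
  have m: "mset (map \<sigma> [1..<Suc n]) = mset_set {1..n}"
  proof -
    have "mset (map \<sigma> [1..<Suc n]) = image_mset \<sigma> (mset_set {1..n})"
      by (simp add: atLeastLessThanSuc_atLeastAtMost del: upt_Suc)
    also have "\<dots> = mset_set (\<sigma> ` {1..n})"
      using p permutes_inj_on by (intro image_mset_mset_set)
    finally show ?thesis using permutes_image[OF p] by simp
  qed
  have "Suc n \<notin> set (map \<sigma> [1..<Suc n])"
    using m by (metis atLeastAtMost_iff finite_atLeastAtMost finite_set_mset_mset_set not_less_eq_eq order_refl set_mset_mset)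
  \<comment> \<open>Without markers the gap condition is automatic.\<close>
  moreover have "successively (\<lambda>x y. x \<noteq> N \<or> y \<noteq> N) (w @ [N])" if "N \<notin> set w" for N :: nat and w
    using that by (induction w rule: induct_list012) auto
  moreover have "word_avoids_321 (map \<sigma> [1..<Suc n])"
    using av unfolding word_avoids_321_map_upt avoids_321_def by (auto simp: less_Suc_eq_le)
  ultimately show "map \<sigma> [1..<Suc n] \<in> configs (Suc n) n 0"
    using m by (simp add: configs_def del: upt_Suc)
next
  fix w assume w: "w \<in> configs (Suc n) n 0"
  then have m: "mset w = mset_set {1..n}" by (simp add: configs_def)
  have d: "distinct w" using m by (metis finite_atLeastAtMost mset_set_set mset_eq_imp_distinct_iff mset_set.infinite finite_set_mset_mset_set set_mset_mset distinct_count_atmost_1 count_mset_set)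
  have s: "set w = {1..n}" using m by (metis finite_atLeastAtMost finite_set_mset_mset_set set_mset_mset)
  have l: "length w = n" using m by (metis size_mset size_mset_set card_atLeastAtMost diff_Suc_1)
  define \<sigma> where "\<sigma> = (\<lambda>i. if i \<in> {1..n} then w ! (i - 1) else i)"
  have mw: "map \<sigma> [1..<Suc n] = w"
    by (rule nth_equalityI) (auto simp: l \<sigma>_def simp del: upt_Suc)
  have "bij_betw \<sigma> {1..n} {1..n}"
  proof -
    have "inj_on \<sigma> {1..n}"
      using d mw distinct_map[of \<sigma> "[1..<Suc n]"] by (simp add: atLeastLessThanSuc_atLeastAtMost del: upt_Suc)
    moreover have "\<sigma> ` {1..n} = {1..n}"
      using s mw by (metis atLeastLessThanSuc_atLeastAtMost list.set_map set_upt)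
    ultimately show ?thesis by (simp add: bij_betw_def)
  qed
  then have "\<sigma> permutes {1..n}" by (rule bij_imp_permutes) (unfold \<sigma>_def, simp only: if_False)
  moreover have "avoids_321 n \<sigma>"
  proof -
    have "word_avoids_321 (map \<sigma> [1..<Suc n])" using w mw by (simp add: configs_def)
    then show ?thesis unfolding word_avoids_321_map_upt avoids_321_def by (auto simp: less_Suc_eq_le)
  qed
  ultimately show "\<exists>\<sigma>\<in>perms_321 n. w = map \<sigma> [1..<Suc n]"
    using mw by (auto simp: perms_321_def)
qed

theorem theorem1p2:
  fixes p q t :: "'a::comm_ring_1" and n :: nat
  shows "C_poly n p q t =
    (\<Sum>\<sigma>\<in>perms_321 n. p ^ stat_2_13_hat n \<sigma> * q ^ stat_31_2 n \<sigma> * t ^ des n \<sigma>)"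
proof -
  \<comment> \<open>The numerator at level \<open>h + 1\<close> factors into the up weight
    \<open>t * q ^ h\<close> and the down weight \<open>p ^ Suc h\<close>.\<close>
  have "C_poly n p q t = motzkin_sum (\<lambda>h. if h = 0 then 1 else p ^ h + q ^ h)
      (\<lambda>h. t * q ^ h) (\<lambda>h. p ^ Suc h) n 0"
    unfolding C_poly_def by (rule jfrac_nth_eq_motzkin_sum) (simp add: mult_ac)
  also have "\<dots> = (\<Sum>w\<in>configs (Suc n) n 0. weight p q t (Suc n) w)"
    by (simp add: sum_weight_configs)
  also have "\<dots> = (\<Sum>\<sigma>\<in>perms_321 n. weight p q t (Suc n) (map \<sigma> [1..<Suc n]))"
    by (rule sum.reindex_bij_betw[OF perms_321_configs, symmetric])
  also have "\<dots> = (\<Sum>\<sigma>\<in>perms_321 n. p ^ stat_2_13_hat n \<sigma> * q ^ stat_31_2 n \<sigma> * t ^ des n \<sigma>)"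
  proof (rule sum.cong[OF refl])
    fix \<sigma> assume "\<sigma> \<in> perms_321 n"
    then have "\<sigma> permutes {1..n}" by (simp add: perms_321_def)
    \<comment> \<open>This identifies the closing letter \<open>N = Suc n\<close> with the value at
      position \<open>n + 1\<close>.\<close>
    then have "\<sigma> (Suc n) = Suc n" by (rule permutes_not_in) simp
    then have "word_2_13 (Suc n) (map \<sigma> [1..<Suc n]) = stat_2_13_hat n \<sigma>"
      unfolding stat_2_13_hat_def by (rule word_2_13_map_upt) simp
    moreover have "word_31_2 (map \<sigma> [1..<Suc n]) = stat_31_2 n \<sigma>"
      unfolding stat_31_2_def by (rule word_31_2_map_upt)
    moreover have "npairs (\<lambda>x y. y < x) (map \<sigma> [1..<Suc n]) = des n \<sigma>"
      by (simp add: npairs_map_upt des_def del: upt_Suc)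
    ultimately show "weight p q t (Suc n) (map \<sigma> [1..<Suc n]) =
        p ^ stat_2_13_hat n \<sigma> * q ^ stat_31_2 n \<sigma> * t ^ des n \<sigma>"
      by (simp only: weight_def)
  qed
  finally show ?thesis .
qed

end
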